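(* Let $c_0>0$ and $s\in\{1,\dots,p\}$. Then the following implications hold. (i) If condition $SRE(s,c_0)$ holds, then condition $RE(s,c_0)$ holds and $\kappa(s,c_0)\ge\theta(s,c_0)$. (ii) If condition $RE(s,c_0)$ holds, then the $s$-sparse eigenvalue condition holds and $\bar\theta_{\min}(s)\ge\kappa(s,c_0)$. (iii) Let $\theta_1>0$. If the $s$-sparse eigenvalue condition holds with $\bar\theta_{\min}(s)\ge\theta_1$, then, for every $s_1\in\{1,\dots,p\}$ with $s_1\le(s-1)\theta_1^2/(2(1+c_0)^2)$, the condition $SRE(s_1,c_0)$ holds and $\theta(s_1,c_0)\ge\theta_1/\sqrt2$.
   Context: Let $\mathbb X\in\mathbb R^{n\times p}$. $\|\boldsymbol u\|_n^2=\frac1n\sum_{i=1}^nu_i^2$; $|\cdot|_q$ is the $\ell_q$ norm on $\mathbb R^p$; $|\boldsymbol\delta|_0$ is the number of nonzero components; $(\boldsymbol e_j)$ is the canonical basis of $\mathbb R^p$; $\delta_1^\sharp\ge\dots\ge\delta_p^\sharp$ is a non-increasing rearrangement of $|\delta_1|,\dots,|\delta_p|$. For $s\in\{1,\dots,p\}$ and $c_0>0$, each of the following three conditions includes the requirement $\|\mathbb X\boldsymbol e_j\|_n\le1$ for all $j=1,\dots,p$, together with: - $RE(s,c_0)$: $\displaystyle\kappa(s,c_0)=\inf_{\boldsymbol\delta\in\mathcal C_{RE}(s,c_0),\boldsymbol\delta\ne\mathbf 0}\frac{\|\mathbb X\boldsymbol\delta\|_n}{|\boldsymbol\delta|_2}>0$,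 where $\mathcal C_{RE}(s,c_0)=\{\boldsymbol\delta\in\mathbb R^p:|\boldsymbol\delta|_1\le(1+c_0)\sum_{j=1}^s\delta_j^\sharp\}$; - $SRE(s,c_0)$: $\displaystyle\theta(s,c_0)=\min_{\boldsymbol\delta\in\mathcal C_{SRE}(s,c_0),\boldsymbol\delta\ne\mathbf 0}\frac{\|\mathbb X\boldsymbol\delta\|_n}{|\boldsymbol\delta|_2}>0$, where $\mathcal C_{SRE}(s,c_0)=\{\boldsymbol\delta\in\mathbb R^p:|\boldsymbol\delta|_1\le(1+c_0)\sqrt s\,|\boldsymbol\delta|_2\}$; - $s$-sparse eigenvalue condition: $\displaystyle\bar\theta_{\min}(s)=\min_{\boldsymbol\delta\ne\mathbf 0,\,|\boldsymbol\delta|_0\le s}\frac{\|\mathbb X\boldsymbol\delta\|_n}{|\boldsymbol\delta|_2}>0$. *)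

theory Defs
  imports "HOL-Analysis.Analysis" "HOL-Library.Multiset"
begin

text \<open>
  The design matrix is \<open>X :: real^'p^'n\<close>, with \<open>n = CARD('n)\<close> rows and \<open>p = CARD('p)\<close> columns.
  The Euclidean norm on \<open>real^'p\<close> is the library's \<open>norm\<close>.
\<close>

definition empirical_norm :: "real^'n \<Rightarrow> real" where
  "empirical_norm u = sqrt (1 / real CARD('n) * (\<Sum>i\<in>UNIV. (u $ i)\<^sup>2))"

definition l1_norm :: "real^'p \<Rightarrow> real" where
  "l1_norm \<delta> = (\<Sum>j\<in>UNIV. \<bar>\<delta> $ j\<bar>)"

definition l0_norm :: "real^'p \<Rightarrow> nat" where
  "l0_norm \<delta> = card {j. \<delta> $ j \<noteq> 0}"

definition abs_desc_list :: "real^'p \<Rightarrow> real list" where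
  "abs_desc_list \<delta> =
     rev (sorted_list_of_multiset (image_mset (\<lambda>j. \<bar>\<delta> $ j\<bar>) (mset_set UNIV)))"

text \<open>Positions are numbered from 1: \<open>rearr \<delta> j\<close> is meaningful for \<open>1 \<le> j \<le> CARD('p)\<close>.\<close>

definition rearr :: "real^'p \<Rightarrow> nat \<Rightarrow> real" where
  "rearr \<delta> j = abs_desc_list \<delta> ! (j - 1)"

lemma mset_abs_desc_list:
  "mset (abs_desc_list \<delta>) = image_mset (\<lambda>j. \<bar>\<delta> $ j\<bar>) (mset_set UNIV)"
  by (simp add: abs_desc_list_def)

lemma length_abs_desc_list: "length (abs_desc_list (\<delta> :: real^'p)) = CARD('p)"
  by (metis mset_abs_desc_list size_image_mset size_mset size_mset_set)

lemma rearr_antimono: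
  fixes \<delta> :: "real^'p"
  assumes "1 \<le> i" "i \<le> j" "j \<le> CARD('p)"
  shows "rearr \<delta> j \<le> rearr \<delta> i"
proof -
  have "sorted (rev (abs_desc_list \<delta>))"
    by (simp add: abs_desc_list_def)
  then show ?thesis
    unfolding rearr_def using assms
    by (intro sorted_rev_nth_mono) (auto simp: length_abs_desc_list)
qed

definition normalized_columns :: "real^'p^'n \<Rightarrow> bool" where
  "normalized_columns X \<longleftrightarrow> (\<forall>j. empirical_norm (X *v axis j 1) \<le> 1)"

definition cone_RE :: "nat \<Rightarrow> real \<Rightarrow> (real^'p) set" where
  "cone_RE s c\<^sub>0 = {\<delta>. l1_norm \<delta> \<le> (1 + c\<^sub>0) * (\<Sum>j=1..s. rearr \<delta> j)}"

definition cone_SRE :: "nat \<Rightarrow> real \<Rightarrow> (real^'p) set" where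
  "cone_SRE s c\<^sub>0 = {\<delta>. l1_norm \<delta> \<le> (1 + c\<^sub>0) * sqrt (real s) * norm \<delta>}"

definition sparse_set :: "nat \<Rightarrow> (real^'p) set" where
  "sparse_set s = {\<delta>. l0_norm \<delta> \<le> s}"

definition ratios :: "real^'p^'n \<Rightarrow> (real^'p) set \<Rightarrow> real set" where
  "ratios X K = {empirical_norm (X *v \<delta>) / norm \<delta> |\<delta>. \<delta> \<in> K \<and> \<delta> \<noteq> 0}"

text \<open>
  \<open>\<kappa>\<close> is an infimum, while \<open>\<theta>\<close> and the sparse eigenvalue are minima (least elements of the set of
  ratios); these are attained for every \<open>X\<close>, see \<open>theta_SRE_is_min\<close> and \<open>theta_min_is_min\<close> below.
\<close>

definition kappa_RE :: "real^'p^'n \<Rightarrow> nat \<Rightarrow> real \<Rightarrow> real" where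
  "kappa_RE X s c\<^sub>0 = Inf (ratios X (cone_RE s c\<^sub>0))"

definition theta_SRE :: "real^'p^'n \<Rightarrow> nat \<Rightarrow> real \<Rightarrow> real" where
  "theta_SRE X s c\<^sub>0 = (LEAST r. r \<in> ratios X (cone_SRE s c\<^sub>0))"

definition theta_min :: "real^'p^'n \<Rightarrow> nat \<Rightarrow> real" where
  "theta_min X s = (LEAST r. r \<in> ratios X (sparse_set s))"

definition RE_condition :: "real^'p^'n \<Rightarrow> nat \<Rightarrow> real \<Rightarrow> bool" where
  "RE_condition X s c\<^sub>0 \<longleftrightarrow> normalized_columns X \<and> kappa_RE X s c\<^sub>0 > 0"

definition SRE_condition :: "real^'p^'n \<Rightarrow> nat \<Rightarrow> real \<Rightarrow> bool" where
  "SRE_condition X s c\<^sub>0 \<longleftrightarrow> normalized_columns X \<and> theta_SRE X s c\<^sub>0 > 0"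

definition sparse_eigenvalue_condition :: "real^'p^'n \<Rightarrow> nat \<Rightarrow> bool" where
  "sparse_eigenvalue_condition X s \<longleftrightarrow> normalized_columns X \<and> theta_min X s > 0"

lemma empirical_norm_scaleR: "empirical_norm (c *\<^sub>R u) = \<bar>c\<bar> * empirical_norm u"
  by (simp add: empirical_norm_def power_mult_distrib flip: sum_distrib_left)
     (simp add: real_sqrt_divide real_sqrt_mult)

lemma l1_norm_scaleR: "l1_norm (c *\<^sub>R \<delta>) = \<bar>c\<bar> * l1_norm \<delta>"
  by (simp add: l1_norm_def abs_mult sum_distrib_left)

lemma ratios_attain:
  fixes X :: "real^'p^'n" and K :: "(real^'p) set"
  assumes cl: "closed K"
    and cone: "\<And>c \<delta>. c > 0 \<Longrightarrow> \<delta> \<in> K \<Longrightarrow> c *\<^sub>R \<delta> \<in> K"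
    and ne: "\<exists>\<delta>\<in>K. \<delta> \<noteq> 0"
  shows "\<exists>r\<in>ratios X K. \<forall>r'\<in>ratios X K. r \<le> r'"
proof -
  let ?S = "K \<inter> sphere 0 1"
  let ?f = "\<lambda>\<delta>. empirical_norm (X *v \<delta>)"
  have unit: "(1 / norm \<delta>) *\<^sub>R \<delta> \<in> ?S \<and> ?f ((1 / norm \<delta>) *\<^sub>R \<delta>) = ?f \<delta> / norm \<delta>"
    if "\<delta> \<in> K" "\<delta> \<noteq> 0" for \<delta>
    using that cone[of "1 / norm \<delta>" \<delta>]
    by (simp add: empirical_norm_scaleR matrix_vector_mult_scaleR)
  have comp: "compact ?S"
    using cl by (simp add: closed_Int_compact)
  have nonempty: "?S \<noteq> {}"
    using ne unit by blast
  have "continuous_on ?S ?f"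
    unfolding empirical_norm_def matrix_vector_mult_def
    by (auto intro!: continuous_intros)
  from continuous_attains_inf[OF comp nonempty this]
  obtain d where d: "d \<in> ?S" "\<And>e. e \<in> ?S \<Longrightarrow> ?f d \<le> ?f e"
    by blast
  have "?f d \<in> ratios X K"
    unfolding ratios_def using d(1) by (auto intro!: exI[of _ d])
  moreover have "?f d \<le> r'" if "r' \<in> ratios X K" for r'
    using that unit d(2) unfolding ratios_def by fastforce
  ultimately show ?thesis by blast
qed

lemma theta_SRE_is_min:
  fixes X :: "real^'p^'n"
  assumes "1 \<le> s" "c\<^sub>0 > 0"
  shows "theta_SRE X s c\<^sub>0 \<in> ratios X (cone_SRE s c\<^sub>0)"
    and "\<And>r. r \<in> ratios X (cone_SRE s c\<^sub>0) \<Longrightarrow> theta_SRE X s c\<^sub>0 \<le> r"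
proof -
  let ?K = "cone_SRE s c\<^sub>0 :: (real^'p) set"
  have "closed ?K"
    unfolding cone_SRE_def l1_norm_def
    by (intro closed_Collect_le continuous_intros)
  moreover have "c *\<^sub>R \<delta> \<in> ?K" if "c > 0" "\<delta> \<in> ?K" for c \<delta>
    using that mult_left_mono[of "l1_norm \<delta>" "(1 + c\<^sub>0) * sqrt s * norm \<delta>" c]
    by (simp add: cone_SRE_def l1_norm_scaleR algebra_simps)
  moreover have "axis j 1 \<in> ?K" for j :: 'p
  proof -
    have "1 * 1 \<le> (1 + c\<^sub>0) * sqrt (real s)"
      using assms by (intro mult_mono) auto
    then show ?thesis
      by (simp add: cone_SRE_def l1_norm_def axis_def if_distrib[of abs] norm_axis_1[unfolded axis_def]
          cong: if_cong)
  qed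
  moreover have "axis j 1 \<noteq> (0 :: real^'p)" for j :: 'p
    by (simp add: axis_eq_0_iff)
  ultimately obtain r where r: "r \<in> ratios X ?K" "\<forall>r'\<in>ratios X ?K. r \<le> r'"
    using ratios_attain[of ?K X] by meson
  then have "theta_SRE X s c\<^sub>0 = r"
    unfolding theta_SRE_def by (intro Least_equality) auto
  with r show "theta_SRE X s c\<^sub>0 \<in> ratios X ?K"
    and "\<And>r. r \<in> ratios X ?K \<Longrightarrow> theta_SRE X s c\<^sub>0 \<le> r" by auto
qed

lemma theta_min_is_min:
  fixes X :: "real^'p^'n"
  assumes "1 \<le> s"
  shows "theta_min X s \<in> ratios X (sparse_set s)"
    and "\<And>r. r \<in> ratios X (sparse_set s) \<Longrightarrow> theta_min X s \<le> r"
proof -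
  let ?K = "sparse_set s :: (real^'p) set"
  have "?K = (\<Union>J\<in>{J. card J \<le> s}. \<Inter>j\<in>-J. {\<delta>. \<delta> $ j = 0})" (is "_ = ?U")
  proof
    show "?K \<subseteq> ?U"
      by (auto simp: sparse_set_def l0_norm_def)
    show "?U \<subseteq> ?K"
    proof
      fix \<delta> :: "real^'p" assume "\<delta> \<in> ?U"
      then obtain J where J: "card J \<le> s" "{j. \<delta> $ j \<noteq> 0} \<subseteq> J" by blast
      then have "card {j. \<delta> $ j \<noteq> 0} \<le> s"
        using card_mono[OF _ J(2)] by simp
      then show "\<delta> \<in> ?K" by (simp add: sparse_set_def l0_norm_def)
    qed
  qed
  moreover have "closed ?U"
    by (intro closed_UN closed_INT ballI closed_Collect_eq continuous_intros) simp
  ultimately have "closed ?K" by simp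
  moreover have "c *\<^sub>R \<delta> \<in> ?K" if "c > 0" "\<delta> \<in> ?K" for c \<delta>
    using that by (simp add: sparse_set_def l0_norm_def)
  moreover have "axis j 1 \<in> ?K" for j :: 'p
    using assms by (simp add: sparse_set_def l0_norm_def axis_def)
  moreover have "axis j 1 \<noteq> (0 :: real^'p)" for j :: 'p
    by (simp add: axis_eq_0_iff)
  ultimately obtain r where r: "r \<in> ratios X ?K" "\<forall>r'\<in>ratios X ?K. r \<le> r'"
    using ratios_attain[of ?K X] by meson
  then have "theta_min X s = r"
    unfolding theta_min_def by (intro Least_equality) auto
  with r show "theta_min X s \<in> ratios X ?K"
    and "\<And>r. r \<in> ratios X ?K \<Longrightarrow> theta_min X s \<le> r" by auto
qed

end

theory Submission
  imports Defs
begin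

text \<open>
  For (i) and (ii) it suffices to nest the cones, since a minimum or infimum of the same ratio over
  a smaller set is larger. By Cauchy--Schwarz the \<open>s\<close> largest entries of \<open>\<bar>\<delta>\<bar>\<close> sum to at most
  \<open>sqrt s * norm \<delta>\<close>, so the RE cone lies in the SRE cone; and an \<open>s\<close>-sparse vector has all of its
  \<open>\<ell>\<^sub>1\<close> mass in its \<open>s\<close> largest entries, so it lies in the RE cone. The latter also
  shows that the RE cone contains nonzero vectors, without which the infimum \<open>\<kappa>\<close> would be
  unspecified.

  For (iii) a sparse vector has to be compared with an arbitrary \<open>x\<close>, and Maurey's empirical method
  does this. Write \<open>x\<close> as the average of the vectors \<open>a\<^sub>j = \<bar>x\<bar>\<^sub>1 sgn(x\<^sub>j) e\<^sub>j\<close> with weights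
  \<open>\<bar>x\<^sub>j\<bar> / \<bar>x\<bar>\<^sub>1\<close>. A sum of \<open>s\<close> independent draws from this distribution is \<open>s\<close>-sparse and has mean
  \<open>s x\<close>, and the expectation of a quadratic form \<open>Q\<close> at this sum is
  \<open>s\<^sup>2 Q(x) + s (E Q(a) - Q(x))\<close>. For \<open>Q(v) = \<parallel>Xv\<parallel>\<^sub>n\<^sup>2 - \<theta>\<^sub>1\<^sup>2 \<bar>v\<bar>\<^sub>2\<^sup>2\<close>, which is nonnegative on sparse
  vectors and at most 1 on the canonical basis, this gives
  \<open>\<theta>\<^sub>1\<^sup>2 \<bar>x\<bar>\<^sub>2\<^sup>2 \<le> \<parallel>Xx\<parallel>\<^sub>n\<^sup>2 + \<bar>x\<bar>\<^sub>1\<^sup>2 / (s - 1)\<close>. On the cone of \<open>SRE(s\<^sub>1, c\<^sub>0)\<close> the last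
  term is at most half of the left-hand side, by the bound on \<open>s\<^sub>1\<close>.

  The probability space is avoided by derandomization: the draws are made one at a time, each time
  taking an outcome at which \<open>Q\<close> does not exceed its average (\<open>maurey_selection\<close>).
\<close>

section \<open>Norms and non-increasing rearrangements\<close>

lemma empirical_norm_nonneg: "0 \<le> empirical_norm u"
  by (simp add: empirical_norm_def sum_nonneg)

lemma empirical_norm_power2: "(empirical_norm (u :: real^'n))\<^sup>2 = (u \<bullet> u) / real CARD('n)"
  by (simp add: empirical_norm_def inner_vec_def power2_eq_square sum_nonneg)

lemma l1_norm_nonneg: "0 \<le> l1_norm \<delta>"
  by (simp add: l1_norm_def sum_nonneg)

lemma l1_norm_pos: "\<delta> \<noteq> 0 \<Longrightarrow> 0 < l1_norm \<delta>"
  by (auto simp: l1_norm_def vec_eq_iff intro: sum_pos2)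

text \<open>Taking \<open>g\<close> to be the identity, the square, or the indicator of the nonzero reals expresses
  \<open>\<ell>\<^sub>1\<close>, \<open>\<ell>\<^sub>2\<close> and \<open>\<ell>\<^sub>0\<close> through the rearrangement.\<close>

lemma sum_rearr:
  fixes \<delta> :: "real^'p" and g :: "real \<Rightarrow> 'a::comm_monoid_add"
  shows "(\<Sum>i=1..CARD('p). g (rearr \<delta> i)) = (\<Sum>j\<in>UNIV. g \<bar>\<delta> $ j\<bar>)"
proof -
  let ?L = "abs_desc_list \<delta>"
  have "(\<Sum>i=1..CARD('p). g (rearr \<delta> i)) = (\<Sum>i<CARD('p). g (?L ! i))"
    by (rule sum.reindex_bij_witness[of _ Suc "\<lambda>i. i - 1"]) (auto simp: rearr_def)
  also have "\<dots> = sum_list (map g ?L)"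
    by (simp add: sum_list_sum_nth length_abs_desc_list atLeast0LessThan)
  also have "\<dots> = sum_mset (image_mset g (mset ?L))"
    by (metis mset_map sum_mset_sum_list)
  also have "\<dots> = (\<Sum>j\<in>UNIV. g \<bar>\<delta> $ j\<bar>)"
    by (simp add: mset_abs_desc_list multiset.map_comp comp_def sum_unfold_sum_mset)
  finally show ?thesis .
qed

lemma rearr_nonneg:
  fixes \<delta> :: "real^'p"
  assumes "1 \<le> i" "i \<le> CARD('p)"
  shows "0 \<le> rearr \<delta> i"
proof -
  have "rearr \<delta> i \<in> set (abs_desc_list \<delta>)"
    using assms by (simp add: rearr_def length_abs_desc_list)
  then have "rearr \<delta> i \<in># image_mset (\<lambda>j. \<bar>\<delta> $ j\<bar>) (mset_set UNIV)"
    by (metis mset_abs_desc_list set_mset_mset)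
  then show ?thesis by auto
qed

text \<open>By monotonicity, a nonzero entry at position \<open>i\<close> would force at least \<open>i\<close> nonzero
  entries.\<close>

lemma rearr_eq_0_beyond_sparsity:
  fixes \<delta> :: "real^'p"
  assumes "l0_norm \<delta> < i" "i \<le> CARD('p)"
  shows "rearr \<delta> i = 0"
proof (rule ccontr)
  assume nz: "rearr \<delta> i \<noteq> 0"
  have pos: "0 < rearr \<delta> k" if "k \<in> {1..i}" for k
    using rearr_antimono[of k i \<delta>] rearr_nonneg[of i \<delta>] nz that assms by auto
  let ?g = "\<lambda>t::real. if t \<noteq> 0 then 1 else (0::nat)"
  have "i = (\<Sum>k=1..i. ?g (rearr \<delta> k))"
    using pos by (auto simp: less_le)
  also have "\<dots> \<le> (\<Sum>k=1..CARD('p). ?g (rearr \<delta> k))"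
    using assms by (intro sum_mono2) auto
  also have "\<dots> = l0_norm \<delta>"
    unfolding sum_rearr[of ?g] by (simp add: l0_norm_def sum.If_cases)
  finally show False using assms by simp
qed

section \<open>Nesting of the cones\<close>

lemma sparse_set_subset_cone_RE:
  assumes "0 \<le> c\<^sub>0" "s \<le> CARD('p)"
  shows "(sparse_set s :: (real^'p) set) \<subseteq> cone_RE s c\<^sub>0"
proof
  fix \<delta> :: "real^'p"
  assume "\<delta> \<in> sparse_set s"
  then have zero: "rearr \<delta> i = 0" if "i \<in> {1..CARD('p)} - {1..s}" for i
    using that by (intro rearr_eq_0_beyond_sparsity) (auto simp: sparse_set_def)
  have "l1_norm \<delta> = (\<Sum>i=1..CARD('p). rearr \<delta> i)"
    using sum_rearr[of "\<lambda>t. t" \<delta>] by (simp add: l1_norm_def)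
  also have "\<dots> = (\<Sum>i=1..s. rearr \<delta> i)"
    using assms zero by (intro sum.mono_neutral_right) auto
  finally have eq: "l1_norm \<delta> = (\<Sum>i=1..s. rearr \<delta> i)" .
  have "l1_norm \<delta> \<le> (1 + c\<^sub>0) * l1_norm \<delta>"
    using assms l1_norm_nonneg[of \<delta>] by (simp add: algebra_simps)
  then show "\<delta> \<in> cone_RE s c\<^sub>0"
    unfolding cone_RE_def mem_Collect_eq by (subst (asm) (2) eq)
qed

lemma cone_RE_subset_cone_SRE:
  assumes "0 \<le> c\<^sub>0" "s \<le> CARD('p)"
  shows "(cone_RE s c\<^sub>0 :: (real^'p) set) \<subseteq> cone_SRE s c\<^sub>0"
proof
  fix \<delta> :: "real^'p"
  assume \<delta>: "\<delta> \<in> cone_RE s c\<^sub>0"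
  have "(\<Sum>i=1..s. rearr \<delta> i)\<^sup>2 \<le> real s * (\<Sum>i=1..s. (rearr \<delta> i)\<^sup>2)"
    using sum_squared_le_sum_of_squares[of "rearr \<delta>" "{1..s}"] by (simp add: mult.commute)
  also have "\<dots> \<le> real s * (\<Sum>i=1..CARD('p). (rearr \<delta> i)\<^sup>2)"
    using assms by (intro mult_left_mono sum_mono2) auto
  also have "\<dots> = real s * (norm \<delta>)\<^sup>2"
    unfolding sum_rearr[of "\<lambda>t. t\<^sup>2"] power2_norm_eq_inner
    by (simp add: inner_vec_def power2_eq_square)
  also have "\<dots> = (sqrt (real s) * norm \<delta>)\<^sup>2"
    by (simp add: power_mult_distrib)
  finally have "(\<Sum>i=1..s. rearr \<delta> i) \<le> sqrt (real s) * norm \<delta>"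
    by (rule power2_le_imp_le) simp
  then have "(1 + c\<^sub>0) * (\<Sum>i=1..s. rearr \<delta> i) \<le> (1 + c\<^sub>0) * (sqrt (real s) * norm \<delta>)"
    using assms by (intro mult_left_mono) auto
  with \<delta> show "\<delta> \<in> cone_SRE s c\<^sub>0"
    by (simp add: cone_RE_def cone_SRE_def mult.assoc)
qed

lemma ratios_mono: "K \<subseteq> K' \<Longrightarrow> ratios X K \<subseteq> ratios X K'"
  by (auto simp: ratios_def)

lemma bdd_below_ratios: "bdd_below (ratios X K)"
  by (rule bdd_belowI[of _ 0]) (auto simp: ratios_def empirical_norm_nonneg)

section \<open>Maurey's selection argument\<close>

lemma exists_le_weighted_average:
  fixes w f :: "'i \<Rightarrow> real"
  assumes "finite I" "\<And>i. i \<in> I \<Longrightarrow> 0 \<le> w i" "sum w I = 1"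
  shows "\<exists>i\<in>I. f i \<le> (\<Sum>k\<in>I. w k * f k)"
proof (rule ccontr)
  let ?m = "\<Sum>k\<in>I. w k * f k"
  assume "\<not> ?thesis"
  then have less: "?m < f i" if "i \<in> I" for i using that by force
  obtain i where i: "i \<in> I" "w i \<noteq> 0"
    using assms(3) by (metis sum.neutral zero_neq_one)
  have "(\<Sum>k\<in>I. w k * ?m) < ?m"
    using i less assms
    by (intro sum_strict_mono_ex1) (auto intro!: bexI[of _ i] mult_left_mono simp: less_le)
  then show False
    using assms(3) by (simp flip: sum_distrib_right)
qed

text \<open>
  The constant added per draw is the variance of \<open>Q v = B v v\<close> under one draw,
  \<open>E Q(a) - Q(x) = E Q(a - x)\<close>: a single draw satisfies \<open>E Q(z + a) = Q(z + x) + E Q(a - x)\<close>.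
  The offset \<open>z\<close> is general because in the induction it collects the draws already made; a draw
  is judged by the form at the draws so far plus the mean of those still to come, so that the
  outcome chosen at one step is good enough for all later ones.
\<close>

lemma maurey_selection:
  fixes B :: "'v::real_vector \<Rightarrow> 'v \<Rightarrow> real" and a :: "'i \<Rightarrow> 'v"
  assumes B: "bilinear B" and sym: "\<And>u v. B u v = B v u"
    and I: "finite I" and w: "\<And>i. i \<in> I \<Longrightarrow> 0 \<le> w i" "sum w I = 1"
    and x: "x = (\<Sum>i\<in>I. w i *\<^sub>R a i)"
  shows "\<exists>js. length js = m \<and>
    B (z + (\<Sum>j\<leftarrow>js. a j)) (z + (\<Sum>j\<leftarrow>js. a j))
      \<le> B (z + real m *\<^sub>R x) (z + real m *\<^sub>R x)
        + real m * ((\<Sum>i\<in>I. w i * B (a i) (a i)) - B x x)"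
proof (induction m arbitrary: z)
  case 0
  then show ?case by simp
next
  case (Suc m)
  let ?V = "(\<Sum>i\<in>I. w i * B (a i) (a i)) - B x x"
  let ?y = "z + real m *\<^sub>R x"
  have Byx: "B y x = (\<Sum>i\<in>I. w i * B y (a i))" for y
  proof -
    interpret linear "B y" using B by (simp add: bilinear_def)
    show ?thesis unfolding x by (simp add: sum scale)
  qed
  have "(\<Sum>i\<in>I. w i * B (?y + a i) (?y + a i))
      = (\<Sum>i\<in>I. w i * B ?y ?y + 2 * (w i * B ?y (a i)) + w i * B (a i) (a i))"
    by (intro sum.cong refl)
       (simp only: bilinear_ladd[OF B, of ?y] bilinear_radd[OF B, of _ ?y] sym[of "a _" ?y],
        simp only: algebra_simps mult_2)
  also have "\<dots> = B ?y ?y + 2 * B ?y x + (\<Sum>i\<in>I. w i * B (a i) (a i))"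
    using w(2) by (simp only: sum.distrib Byx[of ?y] flip: sum_distrib_left sum_distrib_right)
  also have "\<dots> = B (?y + x) (?y + x) + ?V"
    by (simp only: bilinear_ladd[OF B, of ?y] bilinear_radd[OF B, of _ ?y] sym[of x ?y])
  finally have avg: "(\<Sum>i\<in>I. w i * B (?y + a i) (?y + a i)) = B (?y + x) (?y + x) + ?V" .
  obtain i where i: "B (?y + a i) (?y + a i) \<le> B (?y + x) (?y + x) + ?V"
    using exists_le_weighted_average[OF I w, of "\<lambda>i. B (?y + a i) (?y + a i)"] avg by auto
  obtain js where js: "length js = m"
    "B (z + a i + (\<Sum>j\<leftarrow>js. a j)) (z + a i + (\<Sum>j\<leftarrow>js. a j))
      \<le> B (z + a i + real m *\<^sub>R x) (z + a i + real m *\<^sub>R x) + real m * ?V"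
    using Suc.IH[of "z + a i"] by blast
  have "z + a i + real m *\<^sub>R x = ?y + a i" "?y + x = z + real (Suc m) *\<^sub>R x"
    by (simp_all add: algebra_simps)
  with i js show ?case
    by (intro exI[of _ "i # js"]) (simp add: algebra_simps)
qed

lemma l0_norm_sum_list_axis:
  "l0_norm (\<Sum>j\<leftarrow>js. c j *\<^sub>R axis j 1 :: real^'p) \<le> length js"
proof -
  have "(\<Sum>j\<leftarrow>js. c j *\<^sub>R axis j 1 :: real^'p) $ k = 0" if "k \<notin> set js" for k
    using that by (induction js) (auto simp: axis_def)
  then have "{k. (\<Sum>j\<leftarrow>js. c j *\<^sub>R axis j 1 :: real^'p) $ k \<noteq> 0} \<subseteq> set js"
    by blast
  then show ?thesis
    unfolding l0_norm_def by (meson List.finite_set card_length card_mono le_trans)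
qed

text \<open>
  Maurey's selection with zero offset, applied to the signed and rescaled basis vectors whose average
  is \<open>x\<close>, gives a sparse point at which the form is at most
  \<open>s\<^sup>2 B(x,x) + s (E B(a,a) - B(x,x))\<close>; dividing by \<open>s\<close> leaves the factor \<open>s - 1\<close>.
\<close>

lemma quadratic_form_lower_bound_from_sparse:
  fixes B :: "real^'p \<Rightarrow> real^'p \<Rightarrow> real"
  assumes B: "bilinear B" and sym: "\<And>u v. B u v = B v u"
    and sparse: "\<And>v. v \<in> sparse_set s \<Longrightarrow> 0 \<le> B v v"
    and basis: "\<And>j. B (axis j 1) (axis j 1) \<le> b"
    and s: "1 \<le> s"
  shows "0 \<le> (real s - 1) * B x x + b * (l1_norm x)\<^sup>2"
proof (cases "x = 0")
  case True
  then show ?thesis by (simp add: bilinear_lzero[OF B] l1_norm_def)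
next
  case False
  define N where "N = l1_norm x"
  have N: "N > 0" using l1_norm_pos[OF False] by (simp add: N_def)
  define w where "w j = \<bar>x $ j\<bar> / N" for j
  define c where "c j = N * sgn (x $ j)" for j
  define a :: "'p \<Rightarrow> real^'p" where "a j = c j *\<^sub>R axis j 1" for j
  have w0: "0 \<le> w j" for j using N by (simp add: w_def)
  have w1: "sum w UNIV = 1"
    using N by (simp add: w_def N_def l1_norm_def flip: sum_divide_distrib)
  have wc: "w j * c j = x $ j" for j
    using N by (simp add: w_def c_def abs_mult_sgn)
  have x: "x = (\<Sum>j\<in>UNIV. w j *\<^sub>R a j)"
    by (simp add: vec_eq_iff a_def wc axis_def if_distrib cong: if_cong)
  obtain js where js: "length js = s"
    "B (\<Sum>j\<leftarrow>js. a j) (\<Sum>j\<leftarrow>js. a j) \<le> B (real s *\<^sub>R x) (real s *\<^sub>R x)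
        + real s * ((\<Sum>j\<in>UNIV. w j * B (a j) (a j)) - B x x)"
    using maurey_selection[OF B sym finite w0 w1 x, of s 0] by auto
  have "(\<Sum>j\<in>UNIV. w j * B (a j) (a j)) \<le> (\<Sum>j\<in>UNIV. w j * (b * N\<^sup>2))"
  proof (intro sum_mono)
    fix j
    \<comment> \<open>If \<open>x $ j = 0\<close>, then \<open>c j = 0\<close>, but also \<open>w j = 0\<close>; this matters when \<open>b < 0\<close>.\<close>
    show "w j * B (a j) (a j) \<le> w j * (b * N\<^sup>2)"
    proof (cases "x $ j = 0")
      case False
      then have "(c j)\<^sup>2 = N\<^sup>2"
        by (simp add: c_def power_mult_distrib sgn_if)
      then have "B (a j) (a j) = N\<^sup>2 * B (axis j 1) (axis j 1)"
        by (simp add: a_def bilinear_lmul[OF B] bilinear_rmul[OF B] power2_eq_square)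
      then show ?thesis
        using basis[of j] w0[of j]
        by (metis mult.commute mult_left_mono zero_le_power2)
    qed (simp add: w_def)
  qed
  also have "\<dots> = b * N\<^sup>2"
    using w1 by (simp flip: sum_distrib_right)
  finally have avg: "(\<Sum>j\<in>UNIV. w j * B (a j) (a j)) \<le> b * N\<^sup>2" .
  have "0 \<le> B (\<Sum>j\<leftarrow>js. a j) (\<Sum>j\<leftarrow>js. a j)"
    using l0_norm_sum_list_axis[of c js] js(1)
    by (intro sparse) (simp add: sparse_set_def a_def)
  also have "\<dots> \<le> real s * (real s * B x x) + real s * (b * N\<^sup>2 - B x x)"
    using js(2) avg mult_left_mono[of "(\<Sum>j\<in>UNIV. w j * B (a j) (a j)) - B x x" "b * N\<^sup>2 - B x x" "real s"]
    by (simp add: bilinear_lmul[OF B] bilinear_rmul[OF B])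
  also have "\<dots> = real s * ((real s - 1) * B x x + b * N\<^sup>2)"
    by (simp add: algebra_simps)
  finally show ?thesis
    using s by (simp add: zero_le_mult_iff N_def)
qed

text \<open>The form \<open>\<parallel>Xv\<parallel>\<^sub>n\<^sup>2 - \<theta>\<^sup>2 \<bar>v\<bar>\<^sub>2\<^sup>2\<close> is at most \<open>1 - \<theta>\<^sup>2\<close>, hence at most 1, on the canonical basis.\<close>

lemma empirical_norm_lower_bound_from_sparse:
  fixes X :: "real^'p^'n"
  assumes cols: "normalized_columns X"
    and sparse: "\<And>v. v \<in> sparse_set s \<Longrightarrow> \<theta> * norm v \<le> empirical_norm (X *v v)"
    and \<theta>: "0 \<le> \<theta>" and s: "1 \<le> s"
  shows "(real s - 1) * \<theta>\<^sup>2 * (norm x)\<^sup>2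
    \<le> (real s - 1) * (empirical_norm (X *v x))\<^sup>2 + (l1_norm x)\<^sup>2"
proof -
  define B where "B u v = ((X *v u) \<bullet> (X *v v)) / real CARD('n) - \<theta>\<^sup>2 * (u \<bullet> v)" for u v
  have BQ: "B v v = (empirical_norm (X *v v))\<^sup>2 - \<theta>\<^sup>2 * (norm v)\<^sup>2" for v
    by (simp add: B_def empirical_norm_power2 power2_norm_eq_inner)
  have "bilinear B"
    unfolding bilinear_def B_def
    by (auto intro!: linearI simp: matrix_vector_right_distrib matrix_vector_mult_scaleR
        inner_add_left inner_add_right add_divide_distrib algebra_simps)
  moreover have "B u v = B v u" for u v
    by (simp add: B_def inner_commute)
  moreover have "0 \<le> B v v" if "v \<in> sparse_set s" for v
    using power_mono[OF sparse[OF that], of 2] \<theta> by (simp add: BQ power_mult_distrib)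
  moreover have "B (axis j 1) (axis j 1) \<le> 1" for j
  proof -
    have "(empirical_norm (X *v axis j 1))\<^sup>2 \<le> 1"
      using cols empirical_norm_nonneg[of "X *v axis j 1"]
      by (simp add: normalized_columns_def power_le_one)
    moreover have "B (axis j 1) (axis j 1) = (empirical_norm (X *v axis j 1))\<^sup>2 - \<theta>\<^sup>2"
      by (simp add: BQ)
    moreover have "0 \<le> \<theta>\<^sup>2" by simp
    ultimately show ?thesis by linarith
  qed
  ultimately have "0 \<le> (real s - 1) * B x x + 1 * (l1_norm x)\<^sup>2"
    using s by (intro quadratic_form_lower_bound_from_sparse) auto
  then show ?thesis by (simp add: BQ algebra_simps)
qed

section \<open>Comparison of the three conditions\<close>

lemma SRE_imp_RE:
  fixes X :: "real^'p^'n"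
  assumes c: "0 < c\<^sub>0" and s: "1 \<le> s" "s \<le> CARD('p)" and SRE: "SRE_condition X s c\<^sub>0"
  shows "RE_condition X s c\<^sub>0 \<and> theta_SRE X s c\<^sub>0 \<le> kappa_RE X s c\<^sub>0"
proof -
  have "ratios X (cone_RE s c\<^sub>0) \<noteq> {}"
    using theta_min_is_min(1)[OF s(1), of X]
      ratios_mono[OF sparse_set_subset_cone_RE, of c\<^sub>0 s X] c s by auto
  moreover have "theta_SRE X s c\<^sub>0 \<le> r" if "r \<in> ratios X (cone_RE s c\<^sub>0)" for r
    using that theta_SRE_is_min(2)[OF s(1) c]
      ratios_mono[OF cone_RE_subset_cone_SRE, of c\<^sub>0 s X] c s by auto
  ultimately have "theta_SRE X s c\<^sub>0 \<le> kappa_RE X s c\<^sub>0"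
    unfolding kappa_RE_def by (rule cInf_greatest)
  with SRE show ?thesis by (simp add: SRE_condition_def RE_condition_def)
qed

lemma RE_imp_sparse_eigenvalue:
  fixes X :: "real^'p^'n"
  assumes c: "0 < c\<^sub>0" and s: "1 \<le> s" "s \<le> CARD('p)" and RE: "RE_condition X s c\<^sub>0"
  shows "sparse_eigenvalue_condition X s \<and> kappa_RE X s c\<^sub>0 \<le> theta_min X s"
proof -
  have "theta_min X s \<in> ratios X (cone_RE s c\<^sub>0)"
    using theta_min_is_min(1)[OF s(1), of X]
      ratios_mono[OF sparse_set_subset_cone_RE, of c\<^sub>0 s X] c s by auto
  then have "kappa_RE X s c\<^sub>0 \<le> theta_min X s"
    unfolding kappa_RE_def by (intro cInf_lower bdd_below_ratios)
  with RE show ?thesis by (simp add: RE_condition_def sparse_eigenvalue_condition_def)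
qed

lemma sparse_eigenvalue_imp_SRE:
  fixes X :: "real^'p^'n"
  assumes c: "0 < c\<^sub>0" and s: "1 \<le> s" and \<theta>: "0 < \<theta>"
    and eig: "sparse_eigenvalue_condition X s" "\<theta> \<le> theta_min X s"
    and s1: "1 \<le> s\<^sub>1" "real s\<^sub>1 \<le> (real s - 1) * \<theta>\<^sup>2 / (2 * (1 + c\<^sub>0)\<^sup>2)"
  shows "SRE_condition X s\<^sub>1 c\<^sub>0 \<and> \<theta> / sqrt 2 \<le> theta_SRE X s\<^sub>1 c\<^sub>0"
proof -
  have cols: "normalized_columns X"
    using eig by (simp add: sparse_eigenvalue_condition_def)
  have le: "(1 + c\<^sub>0)\<^sup>2 * real s\<^sub>1 \<le> (real s - 1) * \<theta>\<^sup>2 / 2"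
    using s1(2) c by (simp add: field_simps)
  \<comment> \<open>For \<open>s = 1\<close> the bound would allow only \<open>s\<^sub>1 = 0\<close>; so the factor \<open>s - 1\<close> can be cancelled below.\<close>
  have "0 < (1 + c\<^sub>0)\<^sup>2 * real s\<^sub>1" using c s1(1) by simp
  with le have "0 < (real s - 1) * \<theta>\<^sup>2" by simp
  then have sgt: "0 < real s - 1"
    using \<theta> by (simp add: zero_less_mult_iff)
  have sparse: "\<theta> * norm v \<le> empirical_norm (X *v v)" if "v \<in> sparse_set s" for v
  proof (cases "v = 0")
    case True
    then show ?thesis by (simp add: empirical_norm_nonneg)
  next
    case False
    then have "theta_min X s \<le> empirical_norm (X *v v) / norm v"
      using that by (intro theta_min_is_min(2)[OF s]) (auto simp: ratios_def)
    with eig(2) have "\<theta> \<le> empirical_norm (X *v v) / norm v" by linarith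
    with False show ?thesis by (simp add: pos_le_divide_eq)
  qed
  have "\<theta> / sqrt 2 \<le> empirical_norm (X *v x) / norm x"
    if x: "x \<in> cone_SRE s\<^sub>1 c\<^sub>0" "x \<noteq> 0" for x
  proof -
    have "(l1_norm x)\<^sup>2 \<le> ((1 + c\<^sub>0) * sqrt (real s\<^sub>1) * norm x)\<^sup>2"
      using x(1) l1_norm_nonneg[of x] by (intro power_mono) (auto simp: cone_SRE_def)
    also have "\<dots> = (1 + c\<^sub>0)\<^sup>2 * real s\<^sub>1 * (norm x)\<^sup>2"
      by (simp add: power_mult_distrib)
    also have "\<dots> \<le> (real s - 1) * \<theta>\<^sup>2 / 2 * (norm x)\<^sup>2"
      using le by (rule mult_right_mono) simp
    finally have "(real s - 1) * (\<theta>\<^sup>2 * (norm x)\<^sup>2 / 2)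
        \<le> (real s - 1) * (empirical_norm (X *v x))\<^sup>2"
      using empirical_norm_lower_bound_from_sparse[OF cols sparse less_imp_le[OF \<theta>] s, of x]
      by (simp add: field_simps)
    then have "(\<theta> / sqrt 2 * norm x)\<^sup>2 \<le> (empirical_norm (X *v x))\<^sup>2"
      using sgt by (simp add: power_mult_distrib power_divide)
    then have "\<theta> / sqrt 2 * norm x \<le> empirical_norm (X *v x)"
      by (rule power2_le_imp_le) (rule empirical_norm_nonneg)
    with x(2) show ?thesis by (simp add: pos_le_divide_eq)
  qed
  then have "\<theta> / sqrt 2 \<le> theta_SRE X s\<^sub>1 c\<^sub>0"
    using theta_SRE_is_min(1)[OF s1(1) c, of X] by (auto simp: ratios_def)
  moreover have "0 < \<theta> / sqrt 2" using \<theta> by simp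
  ultimately show ?thesis
    using cols by (simp add: SRE_condition_def)
qed

theorem proposition8p1:
  fixes X :: "real^'p^'n" and c\<^sub>0 :: real and s :: nat
  assumes "c\<^sub>0 > 0" and "s \<in> {1..CARD('p)}"
  shows "(SRE_condition X s c\<^sub>0 \<longrightarrow>
            RE_condition X s c\<^sub>0 \<and> kappa_RE X s c\<^sub>0 \<ge> theta_SRE X s c\<^sub>0)
       \<and> (RE_condition X s c\<^sub>0 \<longrightarrow>
            sparse_eigenvalue_condition X s \<and> theta_min X s \<ge> kappa_RE X s c\<^sub>0)
       \<and> (\<forall>\<theta>\<^sub>1 > 0. sparse_eigenvalue_condition X s \<and> theta_min X s \<ge> \<theta>\<^sub>1 \<longrightarrow>
            (\<forall>s\<^sub>1 \<in> {1..CARD('p)}.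
               real s\<^sub>1 \<le> (real s - 1) * \<theta>\<^sub>1\<^sup>2 / (2 * (1 + c\<^sub>0)\<^sup>2) \<longrightarrow>
               SRE_condition X s\<^sub>1 c\<^sub>0 \<and> theta_SRE X s\<^sub>1 c\<^sub>0 \<ge> \<theta>\<^sub>1 / sqrt 2))"
  using assms SRE_imp_RE[of c\<^sub>0 s X] RE_imp_sparse_eigenvalue[of c\<^sub>0 s X]
    sparse_eigenvalue_imp_SRE[of c\<^sub>0 s _ X]
  by (meson atLeastAtMost_iff)

end
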